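(* Let $A$ be a triassociative algebra over a field $K$ and let $\Theta_t=\sum_{i=0}^\infty\theta_it^i$ be a deformation of $A$. Then the infinitesimal $\theta_1$ is a $2$-cocycle in $C^2_{\mathrm{Trias}}(A,A)$, whose cohomology class is well-defined by the equivalence class of $\Theta_t$ (i.e. equivalent deformations have cohomologous infinitesimals). Moreover, if $\theta_i=0$ for $1\le i\le l$, then $\theta_{l+1}$ is a $2$-cocycle in $C^2_{\mathrm{Trias}}(A,A)$.
   Context: All vector spaces and tensor products are over a fixed field $K$. A triassociative algebra is a vector space $A$ with three bilinear operations $L=\dashv$, $R=\vdash$, $M=\bot$ satisfying, for all $x,y,z$, the following $11$ conditions: (1) $L(L(x,y),z)=L(x,L(y,z))$; (2) $L(L(x,y),z)=L(x,R(y,z))$; (3) $L(R(x,y),z)=R(x,L(y,z))$; (4) $R(L(x,y),z)=R(x,R(y,z))$; (5) $R(R(x,y),z)=R(x,R(y,z))$; (6) $L(L(x,y),z)=L(x,M(y,z))$; (7) $L(M(x,y),z)=M(x,L(y,z))$; (8) $M(L(x,y),z)=M(x,R(y,z))$; (9) $M(R(x,y),z)=R(x,M(y,z))$; (10) $R(M(x,y),z)=R(x,R(y,z))$; (11) $M(M(x,y),z)=M(x,M(y,z))$, where $L(x,y)=x\dashv y$, etc. Trees. $T_n$ ($n\ge0$) is the set of planar rooted trees with $n+1$ leaves in which every internal vertex has at least $2$ incoming edges ($T_0=\{|\}$, no internal vertex); $\psi\in T_n$ has degree $|\psi|=n$; leaves are numbered $0,\dots,n$ from left to right. The grafting $\psi_0\vee\cdots\vee\psi_k$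 is obtained by arranging the trees from left to right and joining their roots to a new lowest internal vertex, connected to a new root; every tree of degree $\ge 1$ is uniquely of this form with $k\ge1$. A leaf is left (resp. right) oriented if it is the leftmost (resp. rightmost) incoming edge of the vertex it is attached to; otherwise it is a middle leaf. $d_i\colon T_{n+1}\to T_n$ deletes the $i$th leaf (suppressing any vertex left with one incoming edge). For $\psi=\psi_0\vee\cdots\vee\psi_k\in T_{n+1}$ and $0\le i\le n+1$ define $\circ_i^\psi\in\{\dashv,\vdash,\bot\}$ by: $\circ_0^\psi$ is $\dashv$ if $|\psi_0|=0$ and $k=1$; $\vdash$ if $|\psi_0|>0$; $\bot$ if $|\psi_0|=0$ and $k>1$. For $1\le i\le n$, $\circ_i^\psi$ is $\dashv$, $\vdash$, or $\bot$ according as the $i$th leaf is left oriented, right oriented, or a middle leaf. $\circ_{n+1}^\psi$ is $\dashv$ if $|\psi_k|>0$; $\vdash$ if $k=1$ and $|\psi_1|=0$; $\bot$ if $k>1$ and $|\psi_k|=0$. Cohomology. $C^n_{\mathrm{Trias}}(A,A)=\mathrm{Hom}_K(K[T_n]\otimes A^{\otimes n},A)$ for $n\ge 0$, with coboundary $\delta^n=\sum_{i=0}^{n+1}(-1)^i\delta_i^n\colon C^n_{\mathrm{Trias}}(A,A)\to C^{n+1}_{\mathrm{Trias}}(A,A)$, where for $\psi\in T_{n+1}$, $a_1,\dots,a_{n+1}\in A$: $(\delta_0^nf)(\psi;a_1,\dots,a_{n+1})=a_1\circ_0^\psi f(d_0\psi;a_2,\dots,a_{n+1})$; $(\delta_i^nf)(\psi;a_1,\dots,a_{n+1})=f(d_i\psi;a_1,\dots,a_i\circ_i^\psi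 a_{i+1},\dots,a_{n+1})$ for $1\le i\le n$; $(\delta_{n+1}^nf)(\psi;a_1,\dots,a_{n+1})=f(d_{n+1}\psi;a_1,\dots,a_n)\circ_{n+1}^\psi a_{n+1}$. This is a cochain complex, with cohomology $H^n_{\mathrm{Trias}}(A,A)$. A $2$-cochain $\theta\in C^2_{\mathrm{Trias}}(A,A)$ is identified with a triple $(\lambda,\rho,\mu)$ of bilinear operations on $A$ by $\theta(\psi;x,y)=\lambda(x,y)$, $\rho(x,y)$, $\mu(x,y)$ for $\psi=|\vee(|\vee|)$, $(|\vee|)\vee|$, $|\vee|\vee|$ respectively. A deformation of $A$ is a power series $\Theta_t=\sum_{i=0}^\infty\theta_it^i$ with each $\theta_i=(\lambda_i,\rho_i,\mu_i)\in C^2_{\mathrm{Trias}}(A,A)$ and $\theta_0=(\dashv,\vdash,\bot)$, such that $L_t=\sum\lambda_it^i$, $R_t=\sum\rho_it^i$, $M_t=\sum\mu_it^i$ satisfy conditions (1)-(11) (with $L_t,R_t,M_t$ in place of $L,R,M$, extended linearly to power series) for all $x,y,z\in A$. Its infinitesimal is $\theta_1$. A formal isomorphism of $A$ is a power series $\Phi_t=\sum_{i=0}^\infty\phi_it^i$ with $\phi_i\in C^1_{\mathrm{Trias}}(A,A)\cong\mathrm{Hom}_K(A,A)$ and $\phi_0=\mathrm{Id}_A$. Deformations $\Theta_t=(L_t,R_t,M_t)$ and $\overline\Theta_t=(\overline L_t,\overline R_t,\overline M_t)$ are equivalent if there is a formal isomorphism $\Phi_t$ with $\overline O_t(x,y)=\Phi_tO_t(\Phi_t^{-1}(x),\Phi_t^{-1}(y))$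 for $O=L,R,M$ and all $x,y\in A$. *)

theory Defs
  imports
    "HOL-Computational_Algebra.Formal_Power_Series"
    "HOL-Library.Function_Algebras"
begin

section \<open>Triassociative algebras\<close>

definition trias_identities ::
  "'a set \<Rightarrow> ('a \<Rightarrow> 'a \<Rightarrow> 'a) \<Rightarrow> ('a \<Rightarrow> 'a \<Rightarrow> 'a) \<Rightarrow> ('a \<Rightarrow> 'a \<Rightarrow> 'a) \<Rightarrow> bool" where
  "trias_identities S L R M \<longleftrightarrow> (\<forall>x\<in>S. \<forall>y\<in>S. \<forall>z\<in>S.
     L (L x y) z = L x (L y z) \<and>
     L (L x y) z = L x (R y z) \<and>
     L (R x y) z = R x (L y z) \<and>
     R (L x y) z = R x (R y z) \<and>
     R (R x y) z = R x (R y z) \<and>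
     L (L x y) z = L x (M y z) \<and>
     L (M x y) z = M x (L y z) \<and>
     M (L x y) z = M x (R y z) \<and>
     M (R x y) z = R x (M y z) \<and>
     R (M x y) z = R x (R y z) \<and>
     M (M x y) z = M x (M y z))"

definition bilinear_op :: "('k::field \<Rightarrow> 'a::ab_group_add \<Rightarrow> 'a) \<Rightarrow> ('a \<Rightarrow> 'a \<Rightarrow> 'a) \<Rightarrow> bool" where
  "bilinear_op scale B \<longleftrightarrow>
     (\<forall>x. Vector_Spaces.linear scale scale (\<lambda>y. B x y)) \<and>
     (\<forall>y. Vector_Spaces.linear scale scale (\<lambda>x. B x y))"

text \<open>The operations \<open>L\<close>, \<open>R\<close>, \<open>M\<close> are \<open>\<stileturn>\<close>, \<open>\<turnstile>\<close>, \<open>\<bottom>\<close> respectively.\<close>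

locale triassociative_algebra = vector_space scale
  for scale :: "'k::field \<Rightarrow> 'a::ab_group_add \<Rightarrow> 'a" +
  fixes L R M :: "'a \<Rightarrow> 'a \<Rightarrow> 'a"
  assumes bilinear_L: "bilinear_op scale L"
    and bilinear_R: "bilinear_op scale R"
    and bilinear_M: "bilinear_op scale M"
    and identities: "trias_identities UNIV L R M"

section \<open>Planar trees\<close>

text \<open>\<open>Leaf\<close> is the tree with no internal vertex and \<open>Node [\<psi>\<^sub>0, \<dots>, \<psi>\<^sub>k]\<close> is the
  grafting \<open>\<psi>\<^sub>0 \<or> \<dots> \<or> \<psi>\<^sub>k\<close>; the requirement \<open>k \<ge> 1\<close> is imposed by \<open>wf_tree\<close>.\<close>

datatype tree = Leaf | Node "tree list"

fun wf_tree :: "tree \<Rightarrow> bool" where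
  "wf_tree Leaf = True"
| "wf_tree (Node ts) = (2 \<le> length ts \<and> (\<forall>t\<in>set ts. wf_tree t))"

fun num_leaves :: "tree \<Rightarrow> nat" where
  "num_leaves Leaf = 1"
| "num_leaves (Node ts) = (\<Sum>t\<leftarrow>ts. num_leaves t)"

definition degree_tree :: "tree \<Rightarrow> nat" where
  "degree_tree \<psi> = num_leaves \<psi> - 1"

definition T :: "nat \<Rightarrow> tree set" where
  "T n = {\<psi>. wf_tree \<psi> \<and> num_leaves \<psi> = n + 1}"

text \<open>Leaf deletion. \<open>graft\<close> joins a nonempty list of trees at a new vertex, suppressing that
  vertex if it has only one incoming edge. The tree \<open>Leaf\<close> has no leaf that may be deleted, so the
  value there is irrelevant.\<close>

fun graft :: "tree list \<Rightarrow> tree" where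
  "graft [t] = t"
| "graft ts = Node ts"

fun delete_leaf :: "nat \<Rightarrow> tree \<Rightarrow> tree"
  and delete_leaf_list :: "nat \<Rightarrow> tree list \<Rightarrow> tree list" where
  "delete_leaf i Leaf = Leaf"
| "delete_leaf i (Node ts) = graft (delete_leaf_list i ts)"
| "delete_leaf_list i [] = []"
| "delete_leaf_list i (t # ts) =
     (if i < num_leaves t then (if t = Leaf then ts else delete_leaf i t # ts)
      else t # delete_leaf_list (i - num_leaves t) ts)"

datatype trias_op = Left_op | Right_op | Mid_op

text \<open>\<open>orientation i \<psi>\<close> is \<open>Left_op\<close>, \<open>Right_op\<close> or \<open>Mid_op\<close> according as the \<open>i\<close>th leaf of \<open>\<psi>\<close> is
  left oriented, right oriented or a middle leaf. The Boolean argument of \<open>orientation_list\<close> records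
  whether the head of the list is the leftmost incoming edge of its vertex. The values on \<open>Leaf\<close> and
  on the empty list are irrelevant.\<close>

fun orientation :: "nat \<Rightarrow> tree \<Rightarrow> trias_op"
  and orientation_list :: "bool \<Rightarrow> nat \<Rightarrow> tree list \<Rightarrow> trias_op" where
  "orientation i Leaf = Mid_op"
| "orientation i (Node ts) = orientation_list True i ts"
| "orientation_list leftmost i [] = Mid_op"
| "orientation_list leftmost i (t # ts) =
     (if i < num_leaves t then
        (if t = Leaf then (if leftmost then Left_op else if ts = [] then Right_op else Mid_op)
         else orientation i t)
      else orientation_list False (i - num_leaves t) ts)"

text \<open>The symbol \<open>\<circ>\<^sub>i\<^sup>\<psi>\<close> for \<open>0 \<le> i \<le> |\<psi>|\<close>; it is only used for \<open>|\<psi>| \<ge> 1\<close>.\<close>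

fun circ :: "nat \<Rightarrow> tree \<Rightarrow> trias_op" where
  "circ i Leaf = Mid_op"
| "circ i (Node ts) =
     (if i = 0 then
        (if degree_tree (hd ts) > 0 then Right_op
         else if length ts = 2 then Left_op else Mid_op)
      else if i = degree_tree (Node ts) then
        (if degree_tree (last ts) > 0 then Left_op
         else if length ts = 2 then Right_op else Mid_op)
      else orientation i (Node ts))"

fun apply_op ::
  "('a \<Rightarrow> 'a \<Rightarrow> 'a) \<Rightarrow> ('a \<Rightarrow> 'a \<Rightarrow> 'a) \<Rightarrow> ('a \<Rightarrow> 'a \<Rightarrow> 'a) \<Rightarrow> trias_op \<Rightarrow> 'a \<Rightarrow> 'a \<Rightarrow> 'a" where
  "apply_op L R M Left_op = L"
| "apply_op L R M Right_op = R"
| "apply_op L R M Mid_op = M"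

section \<open>Cochains and cohomology\<close>

text \<open>By the universal property, an element of \<open>Hom(K[T\<^sub>n] \<otimes> A\<^sup>\<otimes>\<^sup>n, A)\<close> is a family, indexed by
  \<open>T\<^sub>n\<close>, of \<open>n\<close>-linear maps, here taking their arguments as a list of length \<open>n\<close>. A cochain is set to
  \<open>0\<close> off its domain, so that equality of cochains is equality of functions and the vector space
  operations on cochains are the pointwise ones.\<close>

type_synonym 'a cochain = "tree \<Rightarrow> 'a list \<Rightarrow> 'a"

definition multilinear ::
  "('k::field \<Rightarrow> 'a::ab_group_add \<Rightarrow> 'a) \<Rightarrow> nat \<Rightarrow> ('a list \<Rightarrow> 'a) \<Rightarrow> bool" where
  "multilinear scale n g \<longleftrightarrow>
     (\<forall>as i. length as = n \<longrightarrow> i < n \<longrightarrow> Vector_Spaces.linear scale scale (\<lambda>x. g (as[i := x])))"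

definition cochains :: "('k::field \<Rightarrow> 'a::ab_group_add \<Rightarrow> 'a) \<Rightarrow> nat \<Rightarrow> 'a cochain set" where
  "cochains scale n =
     {f. (\<forall>\<psi>\<in>T n. multilinear scale n (f \<psi>)) \<and>
         (\<forall>\<psi> as. \<psi> \<notin> T n \<or> length as \<noteq> n \<longrightarrow> f \<psi> as = 0)}"

text \<open>The list \<open>as = [a\<^sub>1, \<dots>, a\<^sub>n\<^sub>+\<^sub>1]\<close> is indexed from \<open>0\<close>, so \<open>a\<^sub>i = as ! (i - 1)\<close>.\<close>

definition coface ::
  "('a \<Rightarrow> 'a \<Rightarrow> 'a) \<Rightarrow> ('a \<Rightarrow> 'a \<Rightarrow> 'a) \<Rightarrow> ('a \<Rightarrow> 'a \<Rightarrow> 'a) \<Rightarrow> nat \<Rightarrow> nat \<Rightarrow> 'a cochain \<Rightarrow> 'a cochain" where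
  "coface L R M n i f \<psi> as =
     (if i = 0 then
        apply_op L R M (circ 0 \<psi>) (hd as) (f (delete_leaf 0 \<psi>) (tl as))
      else if i = n + 1 then
        apply_op L R M (circ (n + 1) \<psi>) (f (delete_leaf (n + 1) \<psi>) (butlast as)) (last as)
      else
        f (delete_leaf i \<psi>)
          (take (i - 1) as @ [apply_op L R M (circ i \<psi>) (as ! (i - 1)) (as ! i)] @ drop (i + 1) as))"

definition coboundary_map ::
  "('k::field \<Rightarrow> 'a::ab_group_add \<Rightarrow> 'a) \<Rightarrow>
   ('a \<Rightarrow> 'a \<Rightarrow> 'a) \<Rightarrow> ('a \<Rightarrow> 'a \<Rightarrow> 'a) \<Rightarrow> ('a \<Rightarrow> 'a \<Rightarrow> 'a) \<Rightarrow> nat \<Rightarrow> 'a cochain \<Rightarrow> 'a cochain" where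
  "coboundary_map scale L R M n f \<psi> as =
     (if \<psi> \<in> T (n + 1) \<and> length as = n + 1
      then \<Sum>i\<in>{0..n + 1}. scale ((- 1) ^ i) (coface L R M n i f \<psi> as)
      else 0)"

definition cocycles ::
  "('k::field \<Rightarrow> 'a::ab_group_add \<Rightarrow> 'a) \<Rightarrow>
   ('a \<Rightarrow> 'a \<Rightarrow> 'a) \<Rightarrow> ('a \<Rightarrow> 'a \<Rightarrow> 'a) \<Rightarrow> ('a \<Rightarrow> 'a \<Rightarrow> 'a) \<Rightarrow> nat \<Rightarrow> 'a cochain set" where
  "cocycles scale L R M n = {f \<in> cochains scale n. coboundary_map scale L R M n f = 0}"

fun coboundaries ::
  "('k::field \<Rightarrow> 'a::ab_group_add \<Rightarrow> 'a) \<Rightarrow>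
   ('a \<Rightarrow> 'a \<Rightarrow> 'a) \<Rightarrow> ('a \<Rightarrow> 'a \<Rightarrow> 'a) \<Rightarrow> ('a \<Rightarrow> 'a \<Rightarrow> 'a) \<Rightarrow> nat \<Rightarrow> 'a cochain set" where
  "coboundaries scale L R M 0 = {0}"
| "coboundaries scale L R M (Suc n) = coboundary_map scale L R M n ` cochains scale n"

definition cohomologous ::
  "('k::field \<Rightarrow> 'a::ab_group_add \<Rightarrow> 'a) \<Rightarrow>
   ('a \<Rightarrow> 'a \<Rightarrow> 'a) \<Rightarrow> ('a \<Rightarrow> 'a \<Rightarrow> 'a) \<Rightarrow> ('a \<Rightarrow> 'a \<Rightarrow> 'a) \<Rightarrow> nat \<Rightarrow> 'a cochain rel" where
  "cohomologous scale L R M n =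
     {(f, g). f \<in> cocycles scale L R M n \<and> g \<in> cocycles scale L R M n \<and>
              f - g \<in> coboundaries scale L R M n}"

definition cohomology_class ::
  "('k::field \<Rightarrow> 'a::ab_group_add \<Rightarrow> 'a) \<Rightarrow>
   ('a \<Rightarrow> 'a \<Rightarrow> 'a) \<Rightarrow> ('a \<Rightarrow> 'a \<Rightarrow> 'a) \<Rightarrow> ('a \<Rightarrow> 'a \<Rightarrow> 'a) \<Rightarrow> nat \<Rightarrow> 'a cochain \<Rightarrow> 'a cochain set" where
  "cohomology_class scale L R M n f = cohomologous scale L R M n `` {f}"

section \<open>Deformations\<close>

text \<open>The triple \<open>(\<lambda>, \<rho>, \<mu>)\<close> of a 2-cochain: its values on the three trees in \<open>T\<^sub>2\<close>.\<close>

definition lam :: "'a cochain \<Rightarrow> 'a \<Rightarrow> 'a \<Rightarrow> 'a" where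
  "lam \<theta> x y = \<theta> (Node [Leaf, Node [Leaf, Leaf]]) [x, y]"

definition rho :: "'a cochain \<Rightarrow> 'a \<Rightarrow> 'a \<Rightarrow> 'a" where
  "rho \<theta> x y = \<theta> (Node [Node [Leaf, Leaf], Leaf]) [x, y]"

definition mu :: "'a cochain \<Rightarrow> 'a \<Rightarrow> 'a \<Rightarrow> 'a" where
  "mu \<theta> x y = \<theta> (Node [Leaf, Leaf, Leaf]) [x, y]"

text \<open>\<open>'a fps\<close> serves as \<open>A[[t]]\<close>, and more generally \<open>'b fps\<close> as the set of power series with
  coefficients in \<open>'b\<close>. A power series of linear or bilinear maps acts on \<open>A[[t]]\<close> by extending
  linearly over power series.\<close>

definition fps_linear_ext :: "('a \<Rightarrow> 'a) fps \<Rightarrow> 'a::ab_group_add fps \<Rightarrow> 'a fps" where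
  "fps_linear_ext \<Phi> X = Abs_fps (\<lambda>n. \<Sum>i\<le>n. fps_nth \<Phi> i (fps_nth X (n - i)))"

definition fps_bilinear_ext ::
  "('a \<Rightarrow> 'a \<Rightarrow> 'a) fps \<Rightarrow> 'a::ab_group_add fps \<Rightarrow> 'a fps \<Rightarrow> 'a fps" where
  "fps_bilinear_ext B X Y = Abs_fps (\<lambda>n.
     \<Sum>(i, j, k)\<in>{(i, j, k). i + j + k = n}. fps_nth B i (fps_nth X j) (fps_nth Y k))"

definition L_ser :: "'a cochain fps \<Rightarrow> 'a::ab_group_add fps \<Rightarrow> 'a fps \<Rightarrow> 'a fps" where
  "L_ser \<Theta> = fps_bilinear_ext (Abs_fps (\<lambda>i. lam (fps_nth \<Theta> i)))"

definition R_ser :: "'a cochain fps \<Rightarrow> 'a::ab_group_add fps \<Rightarrow> 'a fps \<Rightarrow> 'a fps" where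
  "R_ser \<Theta> = fps_bilinear_ext (Abs_fps (\<lambda>i. rho (fps_nth \<Theta> i)))"

definition M_ser :: "'a cochain fps \<Rightarrow> 'a::ab_group_add fps \<Rightarrow> 'a fps \<Rightarrow> 'a fps" where
  "M_ser \<Theta> = fps_bilinear_ext (Abs_fps (\<lambda>i. mu (fps_nth \<Theta> i)))"

definition deformation ::
  "('k::field \<Rightarrow> 'a::ab_group_add \<Rightarrow> 'a) \<Rightarrow>
   ('a \<Rightarrow> 'a \<Rightarrow> 'a) \<Rightarrow> ('a \<Rightarrow> 'a \<Rightarrow> 'a) \<Rightarrow> ('a \<Rightarrow> 'a \<Rightarrow> 'a) \<Rightarrow> 'a cochain fps \<Rightarrow> bool" where
  "deformation scale L R M \<Theta> \<longleftrightarrow>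
     (\<forall>i. fps_nth \<Theta> i \<in> cochains scale 2) \<and>
     lam (fps_nth \<Theta> 0) = L \<and> rho (fps_nth \<Theta> 0) = R \<and> mu (fps_nth \<Theta> 0) = M \<and>
     trias_identities (range fps_const) (L_ser \<Theta>) (R_ser \<Theta>) (M_ser \<Theta>)"

definition infinitesimal :: "'a cochain fps \<Rightarrow> 'a cochain" where
  "infinitesimal \<Theta> = fps_nth \<Theta> 1"

definition formal_isomorphism ::
  "('k::field \<Rightarrow> 'a::ab_group_add \<Rightarrow> 'a) \<Rightarrow> ('a \<Rightarrow> 'a) fps \<Rightarrow> bool" where
  "formal_isomorphism scale \<Phi> \<longleftrightarrow>
     (\<forall>i. Vector_Spaces.linear scale scale (fps_nth \<Phi> i)) \<and> fps_nth \<Phi> 0 = id"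

text \<open>The condition \<open>\<phi>\<^sub>0 = id\<close> makes the action of a formal isomorphism on \<open>A[[t]]\<close> bijective, so
  \<open>inv\<close> below is its two-sided inverse.\<close>

definition equivalent_deformations ::
  "('k::field \<Rightarrow> 'a::ab_group_add \<Rightarrow> 'a) \<Rightarrow> 'a cochain fps \<Rightarrow> 'a cochain fps \<Rightarrow> bool" where
  "equivalent_deformations scale \<Theta> \<Theta>' \<longleftrightarrow>
     (\<exists>\<Phi>. formal_isomorphism scale \<Phi> \<and>
       (\<forall>(O_ser, O_ser') \<in> {(L_ser \<Theta>, L_ser \<Theta>'), (R_ser \<Theta>, R_ser \<Theta>'), (M_ser \<Theta>, M_ser \<Theta>')}.
          \<forall>x y. O_ser' (fps_const x) (fps_const y) =
            fps_linear_ext \<Phi> (O_ser (inv (fps_linear_ext \<Phi>) (fps_const x))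
                                     (inv (fps_linear_ext \<Phi>) (fps_const y)))))"

end

(* Each of the three trees in T_2 carries one component of a 2-cochain, and the eleven trees in T_3
   correspond one to one to the eleven triassociativity axioms: the coboundary of (lambda, rho, mu)
   at a tree is the linearisation of the corresponding axiom. If theta_1, ..., theta_l vanish, the
   coefficient of t^(l+1) in the axioms of a deformation is exactly this linearisation at
   theta_(l+1). For an equivalence Phi, the inverse has first coefficient -phi_1, so comparing
   coefficients of t gives theta_1 - theta'_1 = delta phi_1. *)

theory Submission
  imports Defs
begin

section \<open>Linearity rules for bilinear operations and differences of linear maps\<close>

lemma bilinear_op_simps:
  assumes "bilinear_op scale B"
  shows "B (x + y) z = B x z + B y z" "B z (x + y) = B z x + B z y"
    "B (x - y) z = B x z - B y z" "B z (x - y) = B z x - B z y"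
    "B (- x) z = - B x z" "B z (- x) = - B z x"
    "B 0 z = 0" "B z 0 = 0"
proof -
  interpret l: Vector_Spaces.linear scale scale "\<lambda>x. B x z"
    using assms by (simp add: bilinear_op_def)
  interpret r: Vector_Spaces.linear scale scale "\<lambda>x. B z x"
    using assms by (simp add: bilinear_op_def)
  show "B (x + y) z = B x z + B y z" "B z (x + y) = B z x + B z y"
    "B (x - y) z = B x z - B y z" "B z (x - y) = B z x - B z y"
    "B (- x) z = - B x z" "B z (- x) = - B z x"
    "B 0 z = 0" "B z 0 = 0"
    by (rule l.add r.add l.diff r.diff l.neg r.neg l.zero r.zero)+
qed

lemma linear_diff_fun:
  assumes "Vector_Spaces.linear s1 s2 f" "Vector_Spaces.linear s1 s2 g"
  shows "Vector_Spaces.linear s1 s2 (\<lambda>x. f x - g x)"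
proof -
  interpret f: Vector_Spaces.linear s1 s2 f by fact
  interpret g: Vector_Spaces.linear s1 s2 g by fact
  show ?thesis
    by unfold_locales (simp_all add: f.add g.add f.scale g.scale f.vs2.scale_right_diff_distrib)
qed

section \<open>Classification of the planar trees of degree at most 3\<close>

lemma num_leaves_pos: "wf_tree t \<Longrightarrow> 0 < num_leaves t"
proof (induction t)
  case (Node ts)
  then obtain t us where "ts = t # us" by (cases ts) auto
  with Node show ?case by auto
qed simp

text \<open>Every subtree contributes at least one leaf. This bounds the arity of the root, so that
  each small \<open>T n\<close> can be enumerated by finitely many cases.\<close>

lemma length_le_num_leaves:
  "(\<And>t. t \<in> set ts \<Longrightarrow> wf_tree t) \<Longrightarrow> length ts \<le> num_leaves (Node ts)"
proof (induction ts)
  case (Cons t ts)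
  then show ?case using num_leaves_pos[of t] by fastforce
qed simp

lemma T_0: "T 0 = {Leaf}"
proof -
  have "\<psi> = Leaf" if "wf_tree \<psi>" "num_leaves \<psi> = 1" for \<psi>
  proof (cases \<psi>)
    case (Node ts)
    with that length_le_num_leaves[of ts] show ?thesis by auto
  qed
  then show ?thesis by (auto simp: T_def)
qed

lemma mem_T_iff: "\<psi> \<in> T n \<longleftrightarrow> wf_tree \<psi> \<and> num_leaves \<psi> = Suc n"
  by (simp add: T_def)

text \<open>The pattern for \<open>T_2\<close> and \<open>T_3\<close> as well: split by the arity of
  the root, distribute the leaves among the subtrees, and use the sets already classified in lower
  degrees.\<close>

lemma T_1: "T 1 = {Node [Leaf, Leaf]}"
proof -
  have "\<psi> = Node [Leaf, Leaf]" if \<psi>: "\<psi> \<in> T 1" for \<psi>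
  proof -
    obtain ts where ts: "\<psi> = Node ts" "2 \<le> length ts" "\<forall>t\<in>set ts. wf_tree t"
      "num_leaves (Node ts) = 2"
      using \<psi> by (cases \<psi>) (auto simp: mem_T_iff)
    have "length ts = 2"
      using ts length_le_num_leaves[of ts] by auto
    then obtain a b where ab: "ts = [a, b]"
      by (auto simp: numeral_eq_Suc length_Suc_conv)
    have "num_leaves a = 1" "num_leaves b = 1"
      using ts ab num_leaves_pos[of a] num_leaves_pos[of b] by auto
    then have "a \<in> T 0" "b \<in> T 0" using ts ab by (auto simp: mem_T_iff)
    then show ?thesis using ts ab T_0 by simp
  qed
  then show ?thesis by (auto simp: mem_T_iff)
qed

lemma T_2: "T 2 = {Node [Leaf, Node [Leaf, Leaf]], Node [Node [Leaf, Leaf], Leaf],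
    Node [Leaf, Leaf, Leaf]}" (is "_ = ?S")
proof -
  have "\<psi> \<in> ?S" if \<psi>: "\<psi> \<in> T 2" for \<psi>
  proof -
    obtain ts where ts: "\<psi> = Node ts" "2 \<le> length ts" "\<forall>t\<in>set ts. wf_tree t"
      "num_leaves (Node ts) = 3"
      using \<psi> by (cases \<psi>) (auto simp: mem_T_iff)
    have "length ts = 2 \<or> length ts = 3"
      using ts length_le_num_leaves[of ts] by auto
    then consider a b where "ts = [a, b]" | a b c where "ts = [a, b, c]"
      by (auto simp: numeral_eq_Suc length_Suc_conv)
    then show ?thesis
    proof cases
      case 1
      then have "num_leaves a = 1 \<and> num_leaves b = 2 \<or> num_leaves a = 2 \<and> num_leaves b = 1"
        using ts num_leaves_pos[of a] num_leaves_pos[of b] by auto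
      then have "a \<in> T 0 \<and> b \<in> T 1 \<or> a \<in> T 1 \<and> b \<in> T 0"
        using ts 1 by (auto simp: mem_T_iff)
      then show ?thesis using ts 1 T_0 T_1 by auto
    next
      case 2
      then have "num_leaves a = 1" "num_leaves b = 1" "num_leaves c = 1"
        using ts num_leaves_pos[of a] num_leaves_pos[of b] num_leaves_pos[of c] by auto
      then have "a \<in> T 0" "b \<in> T 0" "c \<in> T 0" using ts 2 by (auto simp: mem_T_iff)
      then show ?thesis using ts 2 T_0 by simp
    qed
  qed
  moreover have "?S \<subseteq> T 2" by (simp add: mem_T_iff)
  ultimately show ?thesis by (rule subset_antisym[OF subsetI])
qed

text \<open>In the order listed, the trees belong to the axioms (1), (2), (6), (3), (4), (5), (10),
  (7), (8), (9), (11). Seven have a binary root, three a ternary one, and the last is the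
  corolla.\<close>

lemma T_3: "T 3 = {
    Node [Leaf, Node [Leaf, Node [Leaf, Leaf]]], Node [Leaf, Node [Node [Leaf, Leaf], Leaf]],
    Node [Leaf, Node [Leaf, Leaf, Leaf]], Node [Node [Leaf, Leaf], Node [Leaf, Leaf]],
    Node [Node [Leaf, Node [Leaf, Leaf]], Leaf], Node [Node [Node [Leaf, Leaf], Leaf], Leaf],
    Node [Node [Leaf, Leaf, Leaf], Leaf],
    Node [Leaf, Leaf, Node [Leaf, Leaf]], Node [Leaf, Node [Leaf, Leaf], Leaf],
    Node [Node [Leaf, Leaf], Leaf, Leaf], Node [Leaf, Leaf, Leaf, Leaf]}" (is "_ = ?S")
proof -
  have "\<psi> \<in> ?S" if \<psi>: "\<psi> \<in> T 3" for \<psi>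
  proof -
    obtain ts where ts: "\<psi> = Node ts" "2 \<le> length ts" "\<forall>t\<in>set ts. wf_tree t"
      "num_leaves (Node ts) = 4"
      using \<psi> by (cases \<psi>) (auto simp: mem_T_iff)
    have "length ts = 2 \<or> length ts = 3 \<or> length ts = 4"
      using ts length_le_num_leaves[of ts] by auto
    then consider a b where "ts = [a, b]" | a b c where "ts = [a, b, c]"
      | a b c d where "ts = [a, b, c, d]"
      by (auto simp: numeral_eq_Suc length_Suc_conv)
    then show ?thesis
    proof cases
      case 1
      then have "num_leaves a = 1 \<and> num_leaves b = 3 \<or> num_leaves a = 2 \<and> num_leaves b = 2 \<or>
          num_leaves a = 3 \<and> num_leaves b = 1"
        using ts num_leaves_pos[of a] num_leaves_pos[of b] by auto
      then have "a \<in> T 0 \<and> b \<in> T 2 \<or> a \<in> T 1 \<and> b \<in> T 1 \<or> a \<in> T 2 \<and> b \<in> T 0"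
        using ts 1 by (auto simp: mem_T_iff)
      then show ?thesis using ts 1 unfolding T_0 T_1 T_2 by auto
    next
      case 2
      then have "num_leaves a = 1 \<and> num_leaves b = 1 \<and> num_leaves c = 2 \<or>
          num_leaves a = 1 \<and> num_leaves b = 2 \<and> num_leaves c = 1 \<or>
          num_leaves a = 2 \<and> num_leaves b = 1 \<and> num_leaves c = 1"
        using ts num_leaves_pos[of a] num_leaves_pos[of b] num_leaves_pos[of c] by auto
      then have "a \<in> T 0 \<and> b \<in> T 0 \<and> c \<in> T 1 \<or> a \<in> T 0 \<and> b \<in> T 1 \<and> c \<in> T 0 \<or>
          a \<in> T 1 \<and> b \<in> T 0 \<and> c \<in> T 0"
        using ts 2 by (auto simp: mem_T_iff)
      then show ?thesis using ts 2 unfolding T_0 T_1 by auto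
    next
      case 3
      then have "num_leaves a = 1" "num_leaves b = 1" "num_leaves c = 1" "num_leaves d = 1"
        using ts num_leaves_pos[of a] num_leaves_pos[of b] num_leaves_pos[of c]
          num_leaves_pos[of d] by auto
      then have "a \<in> T 0" "b \<in> T 0" "c \<in> T 0" "d \<in> T 0" using ts 3 by (auto simp: mem_T_iff)
      then show ?thesis using ts 3 T_0 by simp
    qed
  qed
  moreover have "?S \<subseteq> T 3" by (simp add: mem_T_iff)
  ultimately show ?thesis by (rule subset_antisym[OF subsetI])
qed

section \<open>2-cochains as triples of bilinear operations\<close>

lemma multilinear_2_iff:
  "multilinear scale 2 g \<longleftrightarrow> bilinear_op scale (\<lambda>x y. g [x, y])"
proof
  assume *: "multilinear scale 2 g"
  show "bilinear_op scale (\<lambda>x y. g [x, y])"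
    unfolding bilinear_op_def
  proof safe
    fix x
    show "Vector_Spaces.linear scale scale (\<lambda>y. g [x, y])"
      \<comment> \<open>Only one entry of \<open>[x, x]\<close> survives the update: the other is a
        placeholder for the argument that varies.\<close>
      using *[unfolded multilinear_def, rule_format, of "[x, x]" 1] by simp
    show "Vector_Spaces.linear scale scale (\<lambda>y. g [y, x])"
      using *[unfolded multilinear_def, rule_format, of "[x, x]" 0] by simp
  qed
next
  assume *: "bilinear_op scale (\<lambda>x y. g [x, y])"
  show "multilinear scale 2 g"
    unfolding multilinear_def
  proof (intro allI impI)
    fix as :: "'b list" and i :: nat
    assume "length as = 2" "i < 2"
    then show "Vector_Spaces.linear scale scale (\<lambda>x. g (as[i := x]))"
      using * by (auto simp: bilinear_op_def numeral_eq_Suc length_Suc_conv less_Suc_eq)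
  qed
qed

lemma bilinear_op_components:
  assumes "\<theta> \<in> cochains scale 2"
  shows "bilinear_op scale (lam \<theta>)" "bilinear_op scale (rho \<theta>)" "bilinear_op scale (mu \<theta>)"
proof -
  have "bilinear_op scale (\<lambda>x y. \<theta> \<psi> [x, y])" if "\<psi> \<in> T 2" for \<psi>
    using assms that by (simp add: cochains_def multilinear_2_iff)
  then show "bilinear_op scale (lam \<theta>)" "bilinear_op scale (rho \<theta>)" "bilinear_op scale (mu \<theta>)"
    unfolding lam_def[abs_def] rho_def[abs_def] mu_def[abs_def] by (auto simp: T_2)
qed

section \<open>Coefficients of bilinear extensions at constant series\<close>

lemma fps_bilinear_ext_const_right:
  assumes "\<And>i. bilinear_op scale (fps_nth P i)"
  shows "fps_nth (fps_bilinear_ext P X (fps_const z)) n =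
    (\<Sum>i\<le>n. fps_nth P i (fps_nth X (n - i)) z)"
proof -
  have "fps_nth (fps_bilinear_ext P X (fps_const z)) n =
    (\<Sum>(i, j, k)\<in>{(i, j, k). i + j + k = n}.
      fps_nth P i (fps_nth X j) (fps_nth (fps_const z) k))"
    by (simp add: fps_bilinear_ext_def)
  \<comment> \<open>A constant series has no coefficient beyond index 0, and a bilinear map vanishes
    at 0; so only the triples with \<open>k = 0\<close> contribute.\<close>
  also have "\<dots> = (\<Sum>(i, j, k)\<in>(\<lambda>i. (i, n - i, 0)) ` {..n}.
      fps_nth P i (fps_nth X j) (fps_nth (fps_const z) k))"
  proof (rule sum.mono_neutral_right)
    have "{(i, j, k). i + j + k = n} \<subseteq> {..n} \<times> {..n} \<times> {..n}" by auto
    then show "finite {(i, j, k). i + j + k = n}" by (rule finite_subset) simp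
  qed (auto simp: bilinear_op_simps[OF assms] image_iff)
  also have "\<dots> = (\<Sum>i\<le>n. fps_nth P i (fps_nth X (n - i)) z)"
    by (subst sum.reindex) (auto simp: inj_on_def)
  finally show ?thesis .
qed

lemma fps_bilinear_ext_const_left:
  assumes "\<And>i. bilinear_op scale (fps_nth P i)"
  shows "fps_nth (fps_bilinear_ext P (fps_const x) Y) n =
    (\<Sum>i\<le>n. fps_nth P i x (fps_nth Y (n - i)))"
proof -
  have "fps_nth (fps_bilinear_ext P (fps_const x) Y) n =
    (\<Sum>(i, j, k)\<in>{(i, j, k). i + j + k = n}.
      fps_nth P i (fps_nth (fps_const x) j) (fps_nth Y k))"
    by (simp add: fps_bilinear_ext_def)
  also have "\<dots> = (\<Sum>(i, j, k)\<in>(\<lambda>i. (i, 0, n - i)) ` {..n}.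
      fps_nth P i (fps_nth (fps_const x) j) (fps_nth Y k))"
  proof (rule sum.mono_neutral_right)
    have "{(i, j, k). i + j + k = n} \<subseteq> {..n} \<times> {..n} \<times> {..n}" by auto
    then show "finite {(i, j, k). i + j + k = n}" by (rule finite_subset) simp
  qed (auto simp: bilinear_op_simps[OF assms] image_iff)
  also have "\<dots> = (\<Sum>i\<le>n. fps_nth P i x (fps_nth Y (n - i)))"
    by (subst sum.reindex) (auto simp: inj_on_def)
  finally show ?thesis .
qed

text \<open>Both inner indices must be 0, which leaves the single term \<open>i = n\<close>.\<close>

lemma fps_bilinear_ext_const_const:
  assumes "\<And>i. bilinear_op scale (fps_nth P i)"
  shows "fps_nth (fps_bilinear_ext P (fps_const x) (fps_const y)) n = fps_nth P n x y"
proof -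
  have "fps_nth (fps_bilinear_ext P (fps_const x) (fps_const y)) n =
    (\<Sum>i\<le>n. if i = n then fps_nth P n x y else 0)"
    unfolding fps_bilinear_ext_const_right[OF assms]
    by (intro sum.cong) (auto simp: bilinear_op_simps[OF assms])
  then show ?thesis by simp
qed

section \<open>Linearised axioms and the cocycle condition\<close>

lemma sum_atMost_eq_ends:
  fixes g :: "nat \<Rightarrow> 'a::comm_monoid_add"
  assumes "\<And>i. 1 \<le> i \<Longrightarrow> i \<le> l \<Longrightarrow> g i = 0"
  shows "(\<Sum>i\<le>Suc l. g i) = g 0 + g (Suc l)"
proof -
  have "(\<Sum>i\<le>l. g i) = (\<Sum>i\<in>{0}. g i)"
    by (rule sum.mono_neutral_right) (use assms in \<open>auto simp: Suc_le_eq\<close>)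
  then show ?thesis by simp
qed

text \<open>All eleven axioms have the shape \<open>P (Q x y) z = S x (U y z)\<close>. In the
  coefficient of \<open>t^(l+1)\<close> each term carries an outer factor \<open>P\<close> or
  \<open>S\<close> of index \<open>i\<close>, so the hypothesis kills the terms with
  \<open>1 \<le> i \<le> l\<close> and leaves the two ends on either side. The terms are arranged
  with the signs of the coboundary in degree 2.\<close>

lemma leading_term_identity:
  assumes bil: "\<And>i. bilinear_op scale (fps_nth P i)" "\<And>i. bilinear_op scale (fps_nth Q i)"
    "\<And>i. bilinear_op scale (fps_nth S i)" "\<And>i. bilinear_op scale (fps_nth U i)"
    and van: "\<And>i x y. 1 \<le> i \<Longrightarrow> i \<le> l \<Longrightarrow> fps_nth P i x y = 0 \<and> fps_nth S i x y = 0"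
    and eq: "fps_bilinear_ext P (fps_bilinear_ext Q (fps_const x) (fps_const y)) (fps_const z) =
      fps_bilinear_ext S (fps_const x) (fps_bilinear_ext U (fps_const y) (fps_const z))"
  shows "fps_nth S 0 x (fps_nth U (Suc l) y z) - fps_nth P (Suc l) (fps_nth Q 0 x y) z +
    fps_nth S (Suc l) x (fps_nth U 0 y z) - fps_nth P 0 (fps_nth Q (Suc l) x y) z = 0"
proof -
  have "(\<Sum>i\<le>Suc l. fps_nth P i (fps_nth Q (Suc l - i) x y) z) =
      (\<Sum>i\<le>Suc l. fps_nth S i x (fps_nth U (Suc l - i) y z))"
    using arg_cong[OF eq, of "\<lambda>F. fps_nth F (Suc l)"]
    by (simp only: fps_bilinear_ext_const_left[OF bil(3)] fps_bilinear_ext_const_right[OF bil(1)]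
        fps_bilinear_ext_const_const[OF bil(2)] fps_bilinear_ext_const_const[OF bil(4)])
  then show ?thesis
    by (subst (asm) (1 2) sum_atMost_eq_ends) (simp_all add: van algebra_simps)
qed

context triassociative_algebra
begin

text \<open>The eleven equations follow the order of the axioms; each is the vanishing of the
  coboundary at the tree in \<open>T 3\<close> belonging to that axiom. Within an equation the terms
  come from deleting leaves 0, 1, 2, 3.\<close>

lemma cocycleI:
  assumes \<theta>: "\<theta> \<in> cochains scale 2"
    and eqs: "\<And>x y z.
     L x (lam \<theta> y z) - lam \<theta> (L x y) z + lam \<theta> x (L y z) - L (lam \<theta> x y) z = 0 \<and>
     L x (rho \<theta> y z) - lam \<theta> (L x y) z + lam \<theta> x (R y z) - L (lam \<theta> x y) z = 0 \<and>
     R x (lam \<theta> y z) - lam \<theta> (R x y) z + rho \<theta> x (L y z) - L (rho \<theta> x y) z = 0 \<and>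
     R x (rho \<theta> y z) - rho \<theta> (L x y) z + rho \<theta> x (R y z) - R (lam \<theta> x y) z = 0 \<and>
     R x (rho \<theta> y z) - rho \<theta> (R x y) z + rho \<theta> x (R y z) - R (rho \<theta> x y) z = 0 \<and>
     L x (mu \<theta> y z) - lam \<theta> (L x y) z + lam \<theta> x (M y z) - L (lam \<theta> x y) z = 0 \<and>
     M x (lam \<theta> y z) - lam \<theta> (M x y) z + mu \<theta> x (L y z) - L (mu \<theta> x y) z = 0 \<and>
     M x (rho \<theta> y z) - mu \<theta> (L x y) z + mu \<theta> x (R y z) - M (lam \<theta> x y) z = 0 \<and>
     R x (mu \<theta> y z) - mu \<theta> (R x y) z + rho \<theta> x (M y z) - M (rho \<theta> x y) z = 0 \<and>
     R x (rho \<theta> y z) - rho \<theta> (M x y) z + rho \<theta> x (R y z) - R (mu \<theta> x y) z = 0 \<and>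
     M x (mu \<theta> y z) - mu \<theta> (M x y) z + mu \<theta> x (M y z) - M (mu \<theta> x y) z = 0"
  shows "\<theta> \<in> cocycles scale L R M 2"
proof -
  have "coboundary_map scale L R M 2 \<theta> \<psi> as = 0" for \<psi> as
  proof (cases "\<psi> \<in> T 3 \<and> length as = 3")
    case True
    then obtain x y z where as: "as = [x, y, z]"
      by (auto simp: numeral_eq_Suc length_Suc_conv)
    have range: "{0..2 + 1::nat} = {0, 1, 2, 3}" by auto
    have "coboundary_map scale L R M 2 \<theta> \<psi> as =
        coface L R M 2 0 \<theta> \<psi> as - coface L R M 2 1 \<theta> \<psi> as +
        coface L R M 2 2 \<theta> \<psi> as - coface L R M 2 3 \<theta> \<psi> as"
      using True unfolding coboundary_map_def range by simp
    \<comment> \<open>With the tree fixed, \<open>delete_leaf\<close> and \<open>circ\<close>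
      evaluate, and the alternating sum becomes one of the assumed equations.\<close>
    also have "\<dots> = 0"
      using conjunct1[OF True] eqs[of x y z] unfolding T_3 as
      by (elim insertE emptyE; simp add: coface_def degree_tree_def lam_def rho_def mu_def)
    finally show ?thesis .
  qed (auto simp: coboundary_map_def)
  then show ?thesis using \<theta> by (simp add: cocycles_def fun_eq_iff)
qed

text \<open>For \<open>l = 0\<close> the vanishing condition is empty and the conclusion concerns
  the infinitesimal, so both cocycle claims are covered at once.\<close>

lemma cocycle_first_nonzero_term:
  assumes "deformation scale L R M \<Theta>"
    and zero: "\<And>i. 1 \<le> i \<Longrightarrow> i \<le> l \<Longrightarrow> fps_nth \<Theta> i = 0"
  shows "fps_nth \<Theta> (Suc l) \<in> cocycles scale L R M 2"
proof (rule cocycleI)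
  have coch: "fps_nth \<Theta> i \<in> cochains scale 2" for i
    using assms(1) by (simp add: deformation_def)
  have theta_0: "lam (fps_nth \<Theta> 0) = L" "rho (fps_nth \<Theta> 0) = R" "mu (fps_nth \<Theta> 0) = M"
    and ids: "trias_identities (range fps_const) (L_ser \<Theta>) (R_ser \<Theta>) (M_ser \<Theta>)"
    using assms(1) by (simp_all add: deformation_def)
  show "fps_nth \<Theta> (Suc l) \<in> cochains scale 2" by (rule coch)
  fix x y z
  let ?\<theta> = "fps_nth \<Theta> (Suc l)"
  let ?ser = "\<lambda>A. fps_bilinear_ext (Abs_fps (\<lambda>i. A (fps_nth \<Theta> i)))"
  \<comment> \<open>The variables \<open>A\<close>, \<open>B\<close>, \<open>C\<close>,
    \<open>D\<close> range over the component selectors, so that one argument serves every axiom of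
    the form \<open>A (B x y) z = C x (D y z)\<close>.\<close>
  have lead: "C (fps_nth \<Theta> 0) x (D (fps_nth \<Theta> (Suc l)) y z) -
      A (fps_nth \<Theta> (Suc l)) (B (fps_nth \<Theta> 0) x y) z +
      C (fps_nth \<Theta> (Suc l)) x (D (fps_nth \<Theta> 0) y z) -
      A (fps_nth \<Theta> 0) (B (fps_nth \<Theta> (Suc l)) x y) z = 0"
    if ABCD: "{A, B, C, D} \<subseteq> {lam, rho, mu}"
      and eq: "?ser A (?ser B (fps_const x) (fps_const y)) (fps_const z) =
        ?ser C (fps_const x) (?ser D (fps_const y) (fps_const z))"
    for A B C D :: "'a cochain \<Rightarrow> 'a \<Rightarrow> 'a \<Rightarrow> 'a"
  proof -
    have *: "bilinear_op scale (E (fps_nth \<Theta> j))" if "E \<in> {lam, rho, mu}" for E j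
      using that bilinear_op_components[OF coch] by auto
    have bil: "bilinear_op scale (fps_nth (Abs_fps (\<lambda>i. A (fps_nth \<Theta> i))) j)"
      "bilinear_op scale (fps_nth (Abs_fps (\<lambda>i. B (fps_nth \<Theta> i))) j)"
      "bilinear_op scale (fps_nth (Abs_fps (\<lambda>i. C (fps_nth \<Theta> i))) j)"
      "bilinear_op scale (fps_nth (Abs_fps (\<lambda>i. D (fps_nth \<Theta> i))) j)" for j
      using ABCD by (auto simp only: fps_nth_Abs_fps intro!: *)
    have van: "fps_nth (Abs_fps (\<lambda>i. A (fps_nth \<Theta> i))) j u v = 0 \<and>
        fps_nth (Abs_fps (\<lambda>i. C (fps_nth \<Theta> i))) j u v = 0"
      if "1 \<le> j" "j \<le> l" for j u v
      using zero[OF that] ABCD by (auto simp: lam_def rho_def mu_def)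
    show ?thesis
      using leading_term_identity[OF bil van eq] by simp
  qed
  note ids' = bspec[OF bspec[OF bspec[OF ids[unfolded trias_identities_def L_ser_def R_ser_def
      M_ser_def] rangeI[of fps_const x]] rangeI[of fps_const y]] rangeI[of fps_const z]]
  show "L x (lam ?\<theta> y z) - lam ?\<theta> (L x y) z + lam ?\<theta> x (L y z) - L (lam ?\<theta> x y) z = 0 \<and>
     L x (rho ?\<theta> y z) - lam ?\<theta> (L x y) z + lam ?\<theta> x (R y z) - L (lam ?\<theta> x y) z = 0 \<and>
     R x (lam ?\<theta> y z) - lam ?\<theta> (R x y) z + rho ?\<theta> x (L y z) - L (rho ?\<theta> x y) z = 0 \<and>
     R x (rho ?\<theta> y z) - rho ?\<theta> (L x y) z + rho ?\<theta> x (R y z) - R (lam ?\<theta> x y) z = 0 \<and>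
     R x (rho ?\<theta> y z) - rho ?\<theta> (R x y) z + rho ?\<theta> x (R y z) - R (rho ?\<theta> x y) z = 0 \<and>
     L x (mu ?\<theta> y z) - lam ?\<theta> (L x y) z + lam ?\<theta> x (M y z) - L (lam ?\<theta> x y) z = 0 \<and>
     M x (lam ?\<theta> y z) - lam ?\<theta> (M x y) z + mu ?\<theta> x (L y z) - L (mu ?\<theta> x y) z = 0 \<and>
     M x (rho ?\<theta> y z) - mu ?\<theta> (L x y) z + mu ?\<theta> x (R y z) - M (lam ?\<theta> x y) z = 0 \<and>
     R x (mu ?\<theta> y z) - mu ?\<theta> (R x y) z + rho ?\<theta> x (M y z) - M (rho ?\<theta> x y) z = 0 \<and>
     R x (rho ?\<theta> y z) - rho ?\<theta> (M x y) z + rho ?\<theta> x (R y z) - R (mu ?\<theta> x y) z = 0 \<and>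
     M x (mu ?\<theta> y z) - mu ?\<theta> (M x y) z + mu ?\<theta> x (M y z) - M (mu ?\<theta> x y) z = 0"
    \<comment> \<open>The quadruples below list outer left, inner left, outer right and inner right
      operation of the axioms (1) to (11); \<open>theta_0\<close> turns the components of index 0
      into \<open>L\<close>, \<open>R\<close>, \<open>M\<close>.\<close>
    by (intro conjI
      lead[of lam lam lam lam, unfolded theta_0]
      lead[of lam lam lam rho, unfolded theta_0]
      lead[of lam rho rho lam, unfolded theta_0]
      lead[of rho lam rho rho, unfolded theta_0]
      lead[of rho rho rho rho, unfolded theta_0]
      lead[of lam lam lam mu, unfolded theta_0]
      lead[of lam mu mu lam, unfolded theta_0]
      lead[of mu lam mu rho, unfolded theta_0]
      lead[of mu rho rho mu, unfolded theta_0]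
      lead[of rho mu rho rho, unfolded theta_0]
      lead[of mu mu mu mu, unfolded theta_0];
      use ids' in blast)
qed

section \<open>Coboundaries and equality of cohomology classes\<close>

lemma cochains_diff:
  assumes "f \<in> cochains scale n" "g \<in> cochains scale n"
  shows "f - g \<in> cochains scale n"
  using assms unfolding cochains_def multilinear_def
  by (auto intro!: linear_diff_fun)

lemma bilinear_apply_op: "bilinear_op scale (apply_op L R M c)"
  by (cases c) (simp_all add: bilinear_L bilinear_R bilinear_M)

text \<open>The two outer cofaces respect differences because the operation chosen by
  \<open>circ\<close> is bilinear; the inner ones merely evaluate the cochain.\<close>

lemma coboundary_map_diff:
  "coboundary_map scale L R M n (f - g) =
    coboundary_map scale L R M n f - coboundary_map scale L R M n g"
proof (intro ext)
  fix \<psi> as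
  have "coface L R M n i (f - g) \<psi> as = coface L R M n i f \<psi> as - coface L R M n i g \<psi> as" for i
    by (simp add: coface_def bilinear_op_simps[OF bilinear_apply_op])
  then show "coboundary_map scale L R M n (f - g) \<psi> as =
      (coboundary_map scale L R M n f - coboundary_map scale L R M n g) \<psi> as"
    by (simp add: coboundary_map_def scale_right_diff_distrib sum_subtractf)
qed

lemma coboundaries_diff:
  assumes "f \<in> coboundaries scale L R M n" "g \<in> coboundaries scale L R M n"
  shows "f - g \<in> coboundaries scale L R M n"
proof (cases n)
  case (Suc m)
  then obtain f' g' where "f' \<in> cochains scale m" "g' \<in> cochains scale m"
    "f = coboundary_map scale L R M m f'" "g = coboundary_map scale L R M m g'"
    using assms by auto
  then have "f - g = coboundary_map scale L R M m (f' - g')" "f' - g' \<in> cochains scale m"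
    by (simp_all add: coboundary_map_diff cochains_diff)
  then show ?thesis using Suc by simp
qed (use assms in simp)

text \<open>Coboundaries are closed under subtraction, so modulo coboundaries \<open>f\<close> and
  \<open>g\<close> are related to the same cocycles.\<close>

lemma cohomology_class_eqI:
  assumes "f \<in> cocycles scale L R M n" "g \<in> cocycles scale L R M n"
    and fg: "f - g \<in> coboundaries scale L R M n"
  shows "cohomology_class scale L R M n f = cohomology_class scale L R M n g"
proof -
  have "f - h \<in> coboundaries scale L R M n \<longleftrightarrow> g - h \<in> coboundaries scale L R M n" for h
  proof
    assume "f - h \<in> coboundaries scale L R M n"
    from coboundaries_diff[OF this fg] show "g - h \<in> coboundaries scale L R M n"
      by (simp add: algebra_simps)
  next
    assume gh: "g - h \<in> coboundaries scale L R M n"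
    \<comment> \<open>This expression equals \<open>g - f\<close>: negation is obtained from closure
      under subtraction alone. Subtracting it from \<open>g - h\<close> gives
      \<open>f - h\<close>.\<close>
    have "(g - h) - (f - g) - (g - h) \<in> coboundaries scale L R M n"
      by (intro coboundaries_diff gh fg)
    from coboundaries_diff[OF gh this] show "f - h \<in> coboundaries scale L R M n"
      by (simp add: algebra_simps)
  qed
  then show ?thesis using assms by (auto simp: cohomology_class_def cohomologous_def)
qed

section \<open>1-cochains and their coboundaries\<close>

definition cochain_of_map :: "('a \<Rightarrow> 'a) \<Rightarrow> 'a cochain" where
  "cochain_of_map \<phi> \<psi> as = (if \<psi> \<in> T 1 \<and> length as = 1 then \<phi> (hd as) else 0)"

lemma cochain_of_map_in_cochains:
  assumes "Vector_Spaces.linear scale scale \<phi>"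
  shows "cochain_of_map \<phi> \<in> cochains scale 1"
proof -
  have "Vector_Spaces.linear scale scale (\<lambda>x. cochain_of_map \<phi> \<psi> (as[i := x]))"
    if "\<psi> \<in> T 1" "length as = 1" "i < 1" for \<psi> as i
  proof -
    have "(\<lambda>x. cochain_of_map \<phi> \<psi> (as[i := x])) = \<phi>"
      using that by (auto simp: cochain_of_map_def length_Suc_conv)
    then show ?thesis using assms by simp
  qed
  then show ?thesis by (auto simp: cochains_def multilinear_def cochain_of_map_def)
qed

text \<open>The three right-hand sides are the values of the coboundary of \<open>\<phi>\<close> on
  the trees of \<open>T 2\<close>: deleting any leaf leaves the only tree of \<open>T 1\<close>, and
  all three operations \<open>circ\<close> at a given tree agree.\<close>

lemma coboundary_of_map:
  assumes \<theta>: "\<theta> \<in> cochains scale 2"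
    and "\<And>x y. lam \<theta> x y = L x (\<phi> y) - \<phi> (L x y) + L (\<phi> x) y"
    and "\<And>x y. rho \<theta> x y = R x (\<phi> y) - \<phi> (R x y) + R (\<phi> x) y"
    and "\<And>x y. mu \<theta> x y = M x (\<phi> y) - \<phi> (M x y) + M (\<phi> x) y"
  shows "\<theta> = coboundary_map scale L R M 1 (cochain_of_map \<phi>)"
proof (intro ext)
  fix \<psi> as
  show "\<theta> \<psi> as = coboundary_map scale L R M 1 (cochain_of_map \<phi>) \<psi> as"
  proof (cases "\<psi> \<in> T 2 \<and> length as = 2")
    case True
    then obtain x y where as: "as = [x, y]"
      by (auto simp: numeral_eq_Suc length_Suc_conv)
    have range: "{0..1 + 1::nat} = {0, 1, 2}" by auto
    have "coboundary_map scale L R M 1 (cochain_of_map \<phi>) \<psi> as =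
        coface L R M 1 0 (cochain_of_map \<phi>) \<psi> as - coface L R M 1 1 (cochain_of_map \<phi>) \<psi> as +
        coface L R M 1 2 (cochain_of_map \<phi>) \<psi> as"
      using True unfolding coboundary_map_def range by (simp add: numeral_2_eq_2)
    also have "\<dots> = \<theta> \<psi> as"
      using conjunct1[OF True] assms(2-4)[of x y] unfolding T_2 as
      by (elim insertE emptyE; simp add: coface_def cochain_of_map_def T_1[simplified]
          degree_tree_def lam_def rho_def mu_def)
    finally show ?thesis by simp
  next
    \<comment> \<open>Off the domain both sides take the default value 0.\<close>
    case False
    then show ?thesis using \<theta>
      by (auto simp: coboundary_map_def cochains_def numeral_2_eq_2)
  qed
qed

end

section \<open>Inverting a formal isomorphism\<close>

fun fps_linear_ext_inv_nth :: "('a \<Rightarrow> 'a) fps \<Rightarrow> 'a::ab_group_add fps \<Rightarrow> nat \<Rightarrow> 'a" where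
  "fps_linear_ext_inv_nth \<Phi> X n =
    fps_nth X n - (\<Sum>i<n. fps_nth \<Phi> (n - i) (fps_linear_ext_inv_nth \<Phi> X i))"

declare fps_linear_ext_inv_nth.simps [simp del]

text \<open>As the coefficient of index 0 is the identity, the equation
  \<open>fps_linear_ext \<Phi> Y = X\<close> can be solved for the coefficients of \<open>Y\<close>
  one after another; \<open>fps_linear_ext_inv_nth\<close> is this solution.\<close>

lemma surj_fps_linear_ext:
  assumes "fps_nth \<Phi> 0 = id"
  shows "surj (fps_linear_ext \<Phi>)"
proof (rule surjI)
  fix X
  show "fps_linear_ext \<Phi> (Abs_fps (fps_linear_ext_inv_nth \<Phi> X)) = X"
  proof (rule fps_ext)
    fix n
    have "(\<Sum>i\<le>n. fps_nth \<Phi> i (fps_linear_ext_inv_nth \<Phi> X (n - i))) =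
        (\<Sum>i\<le>n. fps_nth \<Phi> (n - i) (fps_linear_ext_inv_nth \<Phi> X i))"
      by (rule sum.reindex_bij_witness[of _ "\<lambda>i. n - i" "\<lambda>i. n - i"]) auto
    \<comment> \<open>After the reversal of the sum the identity acts on the last term, and the
      recursion for that term cancels all others.\<close>
    also have "\<dots> = (\<Sum>i<n. fps_nth \<Phi> (n - i) (fps_linear_ext_inv_nth \<Phi> X i)) +
        fps_linear_ext_inv_nth \<Phi> X n"
      using assms by (simp flip: lessThan_Suc_atMost)
    also have "\<dots> = fps_nth X n"
      by (subst (2) fps_linear_ext_inv_nth.simps) simp
    finally show "fps_nth (fps_linear_ext \<Phi> (Abs_fps (fps_linear_ext_inv_nth \<Phi> X))) n = fps_nth X n"
      by (simp add: fps_linear_ext_def)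
  qed
qed

text \<open>Surjectivity makes \<open>inv\<close> a right inverse. The first two coefficients of a
  preimage are then forced by comparing coefficients of index 0 and 1.\<close>

lemma inv_fps_linear_ext_const_nth:
  assumes "fps_nth \<Phi> 0 = id" "fps_nth \<Phi> 1 0 = 0"
  shows "fps_nth (inv (fps_linear_ext \<Phi>) (fps_const x)) 0 = x"
    and "fps_nth (inv (fps_linear_ext \<Phi>) (fps_const x)) 1 = - fps_nth \<Phi> 1 x"
proof -
  let ?Y = "inv (fps_linear_ext \<Phi>) (fps_const x)"
  have Y: "fps_linear_ext \<Phi> ?Y = fps_const x"
    using surj_fps_linear_ext[OF assms(1)] by (rule surj_f_inv_f)
  show 0: "fps_nth ?Y 0 = x"
    using arg_cong[OF Y, of "\<lambda>F. fps_nth F 0"] assms by (simp add: fps_linear_ext_def)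
  show "fps_nth ?Y 1 = - fps_nth \<Phi> 1 x"
    using arg_cong[OF Y, of "\<lambda>F. fps_nth F 1"] assms 0
    by (simp add: fps_linear_ext_def eq_neg_iff_add_eq_0)
qed

section \<open>First-order comparison of equivalent deformations\<close>

lemma fps_bilinear_ext_nth_0:
  "fps_nth (fps_bilinear_ext B X Y) 0 = fps_nth B 0 (fps_nth X 0) (fps_nth Y 0)"
proof -
  have "{(i, j, k). i + j + k = (0::nat)} = {(0, 0, 0)}" by auto
  then show ?thesis by (simp add: fps_bilinear_ext_def)
qed

lemma fps_bilinear_ext_nth_1:
  "fps_nth (fps_bilinear_ext B X Y) 1 = fps_nth B 1 (fps_nth X 0) (fps_nth Y 0) +
    fps_nth B 0 (fps_nth X 1) (fps_nth Y 0) + fps_nth B 0 (fps_nth X 0) (fps_nth Y 1)"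
proof -
  have "{(i, j, k). i + j + k = (1::nat)} = {(1, 0, 0), (0, 1, 0), (0, 0, 1)}"
    by (auto simp: add_is_1)
  then show ?thesis by (simp add: fps_bilinear_ext_def add.assoc)
qed

text \<open>At order 1 the transport by \<Phi> adds \<open>fps_nth \<Phi> 1\<close> applied to the
  product, and the inverse subtracts it from each argument in turn.\<close>

lemma equivalent_first_order:
  assumes \<Phi>: "fps_nth \<Phi> 0 = id" "fps_nth \<Phi> 1 0 = 0"
    and bil: "\<And>i. bilinear_op scale (fps_nth B i)" "\<And>i. bilinear_op scale (fps_nth B' i)"
    and eq: "fps_bilinear_ext B' (fps_const x) (fps_const y) =
      fps_linear_ext \<Phi> (fps_bilinear_ext B (inv (fps_linear_ext \<Phi>) (fps_const x))
        (inv (fps_linear_ext \<Phi>) (fps_const y)))"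
  shows "fps_nth B 1 x y - fps_nth B' 1 x y =
    fps_nth B 0 x (fps_nth \<Phi> 1 y) - fps_nth \<Phi> 1 (fps_nth B 0 x y) + fps_nth B 0 (fps_nth \<Phi> 1 x) y"
proof -
  have lin1: "fps_nth (fps_linear_ext \<Phi> Z) 1 = fps_nth Z 1 + fps_nth \<Phi> 1 (fps_nth Z 0)" for Z
    using \<Phi> by (simp add: fps_linear_ext_def)
  have "fps_nth B' 1 x y = fps_nth B 1 x y - fps_nth B 0 (fps_nth \<Phi> 1 x) y -
      fps_nth B 0 x (fps_nth \<Phi> 1 y) + fps_nth \<Phi> 1 (fps_nth B 0 x y)"
    using arg_cong[OF eq, of "\<lambda>F. fps_nth F 1"]
    unfolding lin1 fps_bilinear_ext_const_const[OF bil(2)] fps_bilinear_ext_nth_0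
      fps_bilinear_ext_nth_1 inv_fps_linear_ext_const_nth[OF \<Phi>]
    by (simp add: bilinear_op_simps[OF bil(1)] bilinear_op_simps[OF bil(2)])
  then show ?thesis by (simp add: algebra_simps)
qed

lemma (in triassociative_algebra) equivalent_infinitesimals:
  assumes \<Theta>: "deformation scale L R M \<Theta>" and \<Theta>': "deformation scale L R M \<Theta>'"
    and "equivalent_deformations scale \<Theta> \<Theta>'"
  shows "infinitesimal \<Theta> - infinitesimal \<Theta>' \<in> coboundaries scale L R M 2"
proof -
  obtain \<Phi> where lin: "\<And>i. Vector_Spaces.linear scale scale (fps_nth \<Phi> i)"
    and \<Phi>0: "fps_nth \<Phi> 0 = id"
    and eqs: "\<And>x y. L_ser \<Theta>' (fps_const x) (fps_const y) =
        fps_linear_ext \<Phi> (L_ser \<Theta> (inv (fps_linear_ext \<Phi>) (fps_const x))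
          (inv (fps_linear_ext \<Phi>) (fps_const y)))"
      "\<And>x y. R_ser \<Theta>' (fps_const x) (fps_const y) =
        fps_linear_ext \<Phi> (R_ser \<Theta> (inv (fps_linear_ext \<Phi>) (fps_const x))
          (inv (fps_linear_ext \<Phi>) (fps_const y)))"
      "\<And>x y. M_ser \<Theta>' (fps_const x) (fps_const y) =
        fps_linear_ext \<Phi> (M_ser \<Theta> (inv (fps_linear_ext \<Phi>) (fps_const x))
          (inv (fps_linear_ext \<Phi>) (fps_const y)))"
    using assms(3) unfolding equivalent_deformations_def formal_isomorphism_def by auto
  have \<Phi>1: "fps_nth \<Phi> 1 0 = 0"
    using lin[of 1] by (simp add: module_hom.zero flip: module_hom_iff_linear)
  have coch: "fps_nth \<Theta> i \<in> cochains scale 2" "fps_nth \<Theta>' i \<in> cochains scale 2" for i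
    using \<Theta> \<Theta>' by (simp_all add: deformation_def)
  note bil = bilinear_op_components[OF coch(1)] bilinear_op_components[OF coch(2)]
  have z: "lam (fps_nth \<Theta> 0) = L" "rho (fps_nth \<Theta> 0) = R" "mu (fps_nth \<Theta> 0) = M"
    using \<Theta> by (simp_all add: deformation_def)
  let ?\<theta> = "infinitesimal \<Theta> - infinitesimal \<Theta>'"
  \<comment> \<open>The first coefficient of the equivalence is the 1-cochain that bounds the
    difference.\<close>
  have "?\<theta> = coboundary_map scale L R M 1 (cochain_of_map (fps_nth \<Phi> 1))"
  proof (rule coboundary_of_map)
    show "?\<theta> \<in> cochains scale 2"
      unfolding infinitesimal_def by (intro cochains_diff coch)
    fix x y
    show "lam ?\<theta> x y = L x (fps_nth \<Phi> 1 y) - fps_nth \<Phi> 1 (L x y) + L (fps_nth \<Phi> 1 x) y"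
      using equivalent_first_order[OF \<Phi>0 \<Phi>1 _ _ eqs(1)[unfolded L_ser_def], of scale] bil z
      by (simp add: infinitesimal_def lam_def)
    show "rho ?\<theta> x y = R x (fps_nth \<Phi> 1 y) - fps_nth \<Phi> 1 (R x y) + R (fps_nth \<Phi> 1 x) y"
      using equivalent_first_order[OF \<Phi>0 \<Phi>1 _ _ eqs(2)[unfolded R_ser_def], of scale] bil z
      by (simp add: infinitesimal_def rho_def)
    show "mu ?\<theta> x y = M x (fps_nth \<Phi> 1 y) - fps_nth \<Phi> 1 (M x y) + M (fps_nth \<Phi> 1 x) y"
      using equivalent_first_order[OF \<Phi>0 \<Phi>1 _ _ eqs(3)[unfolded M_ser_def], of scale] bil z
      by (simp add: infinitesimal_def mu_def)
  qed
  moreover have "cochain_of_map (fps_nth \<Phi> 1) \<in> cochains scale 1"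
    using lin by (rule cochain_of_map_in_cochains)
  ultimately show ?thesis by (simp add: numeral_2_eq_2)
qed

theorem theorem4p3:
  fixes scale :: "'k::field \<Rightarrow> 'a::ab_group_add \<Rightarrow> 'a"
    and L R M :: "'a \<Rightarrow> 'a \<Rightarrow> 'a"
    and \<Theta> :: "'a cochain fps"
  assumes "triassociative_algebra scale L R M"
    and "deformation scale L R M \<Theta>"
  shows "infinitesimal \<Theta> \<in> cocycles scale L R M 2 \<and>
    (\<forall>\<Theta>'. deformation scale L R M \<Theta>' \<and> equivalent_deformations scale \<Theta> \<Theta>' \<longrightarrow>
       cohomology_class scale L R M 2 (infinitesimal \<Theta>) =
       cohomology_class scale L R M 2 (infinitesimal \<Theta>')) \<and>
    (\<forall>l. (\<forall>i. 1 \<le> i \<and> i \<le> l \<longrightarrow> fps_nth \<Theta> i = 0) \<longrightarrow>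
       fps_nth \<Theta> (l + 1) \<in> cocycles scale L R M 2)"
proof -
  interpret triassociative_algebra scale L R M by (rule assms)
  \<comment> \<open>Stated for an arbitrary deformation, since equality of classes needs it for both
    members of an equivalent pair.\<close>
  have coc: "infinitesimal \<Theta> \<in> cocycles scale L R M 2" if "deformation scale L R M \<Theta>" for \<Theta>
    using cocycle_first_nonzero_term[OF that, of 0] by (simp add: infinitesimal_def)
  show ?thesis
  proof (intro conjI allI impI)
    show "infinitesimal \<Theta> \<in> cocycles scale L R M 2" by (rule coc[OF assms(2)])
  next
    fix \<Theta>'
    assume "deformation scale L R M \<Theta>' \<and> equivalent_deformations scale \<Theta> \<Theta>'"
    then show "cohomology_class scale L R M 2 (infinitesimal \<Theta>) =
        cohomology_class scale L R M 2 (infinitesimal \<Theta>')"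
      using assms(2) by (intro cohomology_class_eqI coc equivalent_infinitesimals) auto
  next
    fix l
    assume "\<forall>i. 1 \<le> i \<and> i \<le> l \<longrightarrow> fps_nth \<Theta> i = 0"
    then show "fps_nth \<Theta> (l + 1) \<in> cocycles scale L R M 2"
      using cocycle_first_nonzero_term[OF assms(2), of l] by simp
  qed
qed

end
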